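(* Let $t>0$, let $i_1<\dots<i_M$ be real, let $\underline b=(b_2,\dots,b_{M-1})$ satisfy $-\frac{1}{i_{j+1}-i_j}<b_j<\frac{1}{i_j-i_{j-1}}$ for $j=2,\dots,M-1$, and let $\underline k\in\mathbb R_+^{M-2}$. For every integer $p\ge1$ there exists a constant $c>0$, independent of $\underline\lambda\in\mathbb R_+^{M-2}$, such that for all $\underline\lambda\in\mathbb R_+^{M-2}$ and all $j\in\{1,\dots,M\}$, $$\big(\widetilde{\mathcal N}_t(\underline k,\underline\lambda)^{-p}\big)_{j,M+1}<1-c .$$
   Context: Conventions: $\mathbb R_+=[0,\infty)$, $M\ge3$, $\underline\lambda=(\lambda_2,\dots,\lambda_{M-1})$. Set $\widetilde k_j=(i_{j+1}-i_j)(i_j-i_{j-1})k_j$ for $2\le j\le M-1$; for $2\le j\le M-1$, $q_{j,j+1}=\frac{i_j-i_{j-1}}{i_{j+1}-i_{j-1}}(1+(i_{j+1}-i_j)b_j)$, $q_{j,j-1}=\frac{i_{j+1}-i_j}{i_{j+1}-i_{j-1}}(1-(i_j-i_{j-1})b_j)$. $\widetilde{\mathcal N}_t=\widetilde{\mathcal N}_t(\underline k,\underline\lambda)$ is the $(M+1)\times(M+1)$ matrix whose rows $1$, $M$, $M+1$ are those of the identity matrix and, for $2\le j\le M-1$, $\widetilde{\mathcal N}_{t;j,j}=1+t\lambda_j(1+\widetilde k_j)$, $\widetilde{\mathcal N}_{t;j,j+1}=-t\lambda_jq_{j,j+1}$, $\widetilde{\mathcal N}_{t;j,j-1}=-t\lambda_jq_{j,j-1}$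 (neighbours in $\{1,\dots,M\}$), $\widetilde{\mathcal N}_{t;j,M+1}=-t\lambda_j\widetilde k_j$, all other entries $0$. *)

theory Defs
  imports Complex_Main "Jordan_Normal_Form.Gauss_Jordan_Elimination"
begin

text \<open>
  Finite families such as \<open>i\<^sub>1, \<dots>, i\<^sub>M\<close> or \<open>\<lambda>\<^sub>2, \<dots>, \<lambda>\<^sub>M\<^sub>-\<^sub>1\<close> are functions \<open>nat \<Rightarrow> real\<close>
  with the one-based indexing of the mathematics; values outside the index range
  are never inspected.
\<close>

definition k_tilde :: "(nat \<Rightarrow> real) \<Rightarrow> (nat \<Rightarrow> real) \<Rightarrow> nat \<Rightarrow> real" where
  "k_tilde i k j = (i (j + 1) - i j) * (i j - i (j - 1)) * k j"

definition q_up :: "(nat \<Rightarrow> real) \<Rightarrow> (nat \<Rightarrow> real) \<Rightarrow> nat \<Rightarrow> real" where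
  "q_up i b j = (i j - i (j - 1)) / (i (j + 1) - i (j - 1)) * (1 + (i (j + 1) - i j) * b j)"

definition q_down :: "(nat \<Rightarrow> real) \<Rightarrow> (nat \<Rightarrow> real) \<Rightarrow> nat \<Rightarrow> real" where
  "q_down i b j = (i (j + 1) - i j) / (i (j + 1) - i (j - 1)) * (1 - (i j - i (j - 1)) * b j)"

text \<open>Entry in row \<open>r\<close> and column \<open>c\<close>, both in \<open>{1..M + 1}\<close>.\<close>

definition N_tilde_entry ::
  "nat \<Rightarrow> (nat \<Rightarrow> real) \<Rightarrow> (nat \<Rightarrow> real) \<Rightarrow> real \<Rightarrow> (nat \<Rightarrow> real) \<Rightarrow> (nat \<Rightarrow> real) \<Rightarrow> nat \<Rightarrow> nat \<Rightarrow> real"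
where
  "N_tilde_entry M i b t k l r c =
    (if r \<in> {2..M - 1} then
       (if c = r then 1 + t * l r * (1 + k_tilde i k r)
        else if c = r + 1 then - t * l r * q_up i b r
        else if c = r - 1 then - t * l r * q_down i b r
        else if c = M + 1 then - t * l r * k_tilde i k r
        else 0)
     else (if c = r then 1 else 0))"

text \<open>The library's matrices are indexed from zero, hence the shift.\<close>

definition N_tilde ::
  "nat \<Rightarrow> (nat \<Rightarrow> real) \<Rightarrow> (nat \<Rightarrow> real) \<Rightarrow> real \<Rightarrow> (nat \<Rightarrow> real) \<Rightarrow> (nat \<Rightarrow> real) \<Rightarrow> real mat"
where
  "N_tilde M i b t k l =
    mat (M + 1) (M + 1) (\<lambda>(r, c). N_tilde_entry M i b t k l (r + 1) (c + 1))"

text \<open>\<open>A\<^sup>-\<^sup>p\<close>, meaningful only for invertible \<open>A\<close>, since \<open>mat_inverse\<close> yields \<open>None\<close> otherwise.\<close>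

definition mat_neg_pow :: "real mat \<Rightarrow> nat \<Rightarrow> real mat" where
  "mat_neg_pow A p = the (mat_inverse A) ^\<^sub>m p"

end

theory Submission
  imports Defs "Jordan_Normal_Form.Determinant"
begin

text \<open>
  The rows of \<open>N = N_tilde M i b t k l\<close> sum to 1 and its off-diagonal entries are nonpositive, so
  \<open>N\<close> satisfies a maximum principle: \<open>N x \<ge> 0\<close> implies \<open>x \<ge> 0\<close>. Hence \<open>N\<close> is invertible, and a
  vector \<open>h\<close> with \<open>h \<le> N h\<close> that dominates the last unit vector also dominates its images under
  all powers of the inverse. The barrier \<open>h\<^sub>j = 1 - K\<^sup>j\<^sup>-\<^sup>1 / K\<^sup>M\<close> for \<open>j \<le> M\<close>, \<open>h\<^bsub>M+1\<^esub> = 1\<close>, has this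
  property for every \<open>l \<ge> 0\<close> as soon as \<open>K \<ge> 1\<close> and \<open>K q\<^bsub>j,j+1\<^esub> \<ge> 1 + k_tilde j\<close> for all \<open>j\<close>, and it
  is bounded away from 1 in the first \<open>M\<close> coordinates.
\<close>

lemma Z_mat_nonneg_solution:
  fixes A :: "real mat"
  assumes A: "A \<in> carrier_mat n n"
    and off: "\<And>r c. r < n \<Longrightarrow> c < n \<Longrightarrow> c \<noteq> r \<Longrightarrow> A $$ (r, c) \<le> 0"
    and row: "\<And>r. r < n \<Longrightarrow> 0 < (\<Sum>c<n. A $$ (r, c))"
    and x: "x \<in> carrier_vec n" and nonneg: "0\<^sub>v n \<le> A *\<^sub>v x"
  shows "0\<^sub>v n \<le> x"
proof (rule ccontr)
  assume "\<not> 0\<^sub>v n \<le> x"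
  then obtain r where r: "r < n" "x $ r < 0"
    using x by (auto simp: less_eq_vec_def not_le)
  define m where "m = arg_min_on (\<lambda>c. x $ c) {..<n}"
  have mn: "m < n"
    using arg_min_if_finite(1)[of "{..<n}" "\<lambda>c. x $ c"] r(1) unfolding m_def by auto
  have min: "x $ m \<le> x $ c" if "c < n" for c
    using arg_min_least[of "{..<n}" c "\<lambda>c. x $ c"] that unfolding m_def by auto
  have neg: "x $ m < 0"
    using min[OF r(1)] r(2) by simp
  have "(A *\<^sub>v x) $ m = (\<Sum>c<n. A $$ (m, c) * x $ c)"
    using A x mn by (simp add: scalar_prod_def atLeast0LessThan)
  also have "\<dots> \<le> (\<Sum>c<n. A $$ (m, c) * x $ m)"
  proof (rule sum_mono)
    fix c assume "c \<in> {..<n}"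
    then show "A $$ (m, c) * x $ c \<le> A $$ (m, c) * x $ m"
      using off[OF mn, of c] min[of c] by (cases "c = m") (auto intro: mult_left_mono_neg)
  qed
  also have "\<dots> = (\<Sum>c<n. A $$ (m, c)) * x $ m"
    by (simp add: sum_distrib_right)
  also have "\<dots> < 0"
    using row[OF mn] neg by (rule mult_pos_neg)
  finally show False
    using nonneg mn A by (auto simp: less_eq_vec_def not_less[symmetric])
qed

definition monotone_mat :: "nat \<Rightarrow> real mat \<Rightarrow> bool" where
  "monotone_mat n A \<longleftrightarrow> A \<in> carrier_mat n n \<and>
     (\<forall>x\<in>carrier_vec n. 0\<^sub>v n \<le> A *\<^sub>v x \<longrightarrow> 0\<^sub>v n \<le> x)"

lemma monotone_mat_inverse:
  assumes "monotone_mat n A"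
  obtains B where "mat_inverse A = Some B" "A * B = 1\<^sub>m n" "B * A = 1\<^sub>m n" "B \<in> carrier_mat n n"
proof -
  have A: "A \<in> carrier_mat n n"
    and mono: "\<And>x. x \<in> carrier_vec n \<Longrightarrow> 0\<^sub>v n \<le> A *\<^sub>v x \<Longrightarrow> 0\<^sub>v n \<le> x"
    using assms by (auto simp: monotone_mat_def)
  have "det A \<noteq> 0"
  proof
    assume "det A = 0"
    then obtain v where v: "v \<in> carrier_vec n" "v \<noteq> 0\<^sub>v n" "A *\<^sub>v v = 0\<^sub>v n"
      using det_0_iff_vec_prod_zero[OF A] by blast
    have "A *\<^sub>v ((-1) \<cdot>\<^sub>v v) = 0\<^sub>v n"
      using mult_mat_vec[OF A v(1), of "-1"] v(3) by auto
    then have "0\<^sub>v n \<le> v" "0\<^sub>v n \<le> (-1) \<cdot>\<^sub>v v"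
      using mono[of v] mono[of "(-1) \<cdot>\<^sub>v v"] v by auto
    then have "v = 0\<^sub>v n"
      using v(1) by (intro eq_vecI) (auto simp: less_eq_vec_def intro: order.antisym)
    with v show False by simp
  qed
  then have "mat_inverse A \<noteq> None"
    using mat_inverse(1)[OF A, where b = "()"] det_non_zero_imp_unit[OF A, where b = "()"] by blast
  then show ?thesis
    using mat_inverse(2)[OF A] that by blast
qed

lemma invertible_monotone_mat:
  assumes "monotone_mat n A"
  shows "invertible_mat A"
proof -
  obtain B where "A * B = 1\<^sub>m n" "B * A = 1\<^sub>m n" "B \<in> carrier_mat n n"
    using monotone_mat_inverse[OF assms] .
  with assms show ?thesis
    by (auto simp: invertible_mat_def inverts_mat_def monotone_mat_def)
qed

lemma mat_neg_pow_mult_vec_le: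
  assumes "monotone_mat n A"
    and h: "h \<in> carrier_vec n" "h \<le> A *\<^sub>v h"
    and v: "v \<in> carrier_vec n" "v \<le> h"
  shows "mat_neg_pow A p *\<^sub>v v \<le> h"
proof -
  obtain B where inv: "mat_inverse A = Some B" "A * B = 1\<^sub>m n" and B: "B \<in> carrier_mat n n"
    using monotone_mat_inverse[OF assms(1)] .
  have A: "A \<in> carrier_mat n n"
    using assms(1) by (simp add: monotone_mat_def)
  have step: "B *\<^sub>v w \<le> h" if w: "w \<in> carrier_vec n" "w \<le> h" for w
  proof -
    have "A *\<^sub>v (h - B *\<^sub>v w) = A *\<^sub>v h - w"
      using A B h(1) w(1) inv(2)
      by (simp add: mult_minus_distrib_mat_vec[of _ n n] assoc_mult_mat_vec[symmetric])
    moreover have "0\<^sub>v n \<le> A *\<^sub>v h - w"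
      using order_trans[OF w(2) h(2)] w(1) A by (auto simp: less_eq_vec_def)
    ultimately have "0\<^sub>v n \<le> h - B *\<^sub>v w"
      using assms(1) h(1) w(1) B by (simp add: monotone_mat_def)
    then show ?thesis
      using h(1) B by (auto simp: less_eq_vec_def)
  qed
  have "B ^\<^sub>m p *\<^sub>v v \<le> h"
    using v
  proof (induction p arbitrary: v)
    case 0
    then show ?case using B by auto
  next
    case (Suc p)
    have "B ^\<^sub>m Suc p *\<^sub>v v = B ^\<^sub>m p *\<^sub>v (B *\<^sub>v v)"
      using B Suc.prems(1) by (simp add: assoc_mult_mat_vec[of _ n n _ n])
    then show ?case
      using Suc step B by simp
  qed
  then show ?thesis
    by (simp add: mat_neg_pow_def inv(1))
qed

lemma strict_mono_on_neighbours:
  fixes i :: "nat \<Rightarrow> real"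
  assumes "strict_mono_on {1..M} i" "j \<in> {2..M - 1}"
  shows "i (j - 1) < i j" "i j < i (j + 1)"
proof -
  have "j - 1 \<in> {1..M}" "j \<in> {1..M}" "j + 1 \<in> {1..M}" "j - 1 < j" "j < j + 1"
    using assms(2) by auto
  then show "i (j - 1) < i j" "i j < i (j + 1)"
    using assms(1) by (blast intro: strict_mono_onD)+
qed

lemma q_up_plus_q_down:
  assumes "i (j - 1) < i j" "i j < i (j + 1)"
  shows "q_up i b j + q_down i b j = 1"
proof -
  have "q_up i b j + q_down i b j = (i (j + 1) - i (j - 1)) / (i (j + 1) - i (j - 1))"
    unfolding q_up_def q_down_def times_divide_eq_left add_divide_distrib[symmetric]
    by (simp add: algebra_simps)
  then show ?thesis
    using assms by simp
qed

lemma q_up_pos: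
  assumes "i (j - 1) < i j" "i j < i (j + 1)" "- (1 / (i (j + 1) - i j)) < b j"
  shows "0 < q_up i b j"
proof -
  have "0 < 1 + (i (j + 1) - i j) * b j"
    using assms by (simp add: field_simps)
  with assms show ?thesis
    unfolding q_up_def by (intro mult_pos_pos divide_pos_pos) auto
qed

lemma q_down_pos:
  assumes "i (j - 1) < i j" "i j < i (j + 1)" "b j < 1 / (i j - i (j - 1))"
  shows "0 < q_down i b j"
proof -
  have "0 < 1 - (i j - i (j - 1)) * b j"
    using assms by (simp add: field_simps)
  with assms show ?thesis
    unfolding q_down_def by (intro mult_pos_pos divide_pos_pos) auto
qed

lemma k_tilde_nonneg:
  assumes "i (j - 1) < i j" "i j < i (j + 1)" "0 \<le> k j"
  shows "0 \<le> k_tilde i k j"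
  using assms by (simp add: k_tilde_def)

lemma N_tilde_carrier: "N_tilde M i b t k l \<in> carrier_mat (M + 1) (M + 1)"
  by (simp add: N_tilde_def)

lemma N_tilde_row_sum_boundary:
  assumes "r < M + 1" "r + 1 \<notin> {2..M - 1}"
  shows "(\<Sum>c<M + 1. N_tilde M i b t k l $$ (r, c) * x c) = x r"
proof -
  have "(\<Sum>c<M + 1. N_tilde M i b t k l $$ (r, c) * x c) = (\<Sum>c<M + 1. if c = r then x c else 0)"
    using assms by (intro sum.cong) (auto simp: N_tilde_def N_tilde_entry_def)
  then show ?thesis
    using assms(1) by simp
qed

lemma N_tilde_row_sum_interior:
  assumes j: "j \<in> {2..M - 1}"
  shows "(\<Sum>c<M + 1. N_tilde M i b t k l $$ (j - 1, c) * x c) =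
    x (j - 1) + t * l j * ((1 + k_tilde i k j) * x (j - 1)
      - q_up i b j * x j - q_down i b j * x (j - 2) - k_tilde i k j * x M)"
proof -
  obtain m where m: "j = m + 2" "m + 3 \<le> M"
    using j that[of "j - 2"] by auto
  have "(\<Sum>c<M + 1. N_tilde M i b t k l $$ (j - 1, c) * x c) =
    (\<Sum>c<M + 1. (if c = j - 1 then (1 + t * l j * (1 + k_tilde i k j)) * x c else 0)
      + (if c = j then - t * l j * q_up i b j * x c else 0)
      + (if c = j - 2 then - t * l j * q_down i b j * x c else 0)
      + (if c = M then - t * l j * k_tilde i k j * x c else 0))"
  proof (rule sum.cong)
    fix c assume c: "c \<in> {..<M + 1}"
    consider "c = m" | "c = m + 1" | "c = m + 2" | "c = M" | "c \<notin> {m, m + 1, m + 2, M}"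
      by blast
    then show "N_tilde M i b t k l $$ (j - 1, c) * x c =
      (if c = j - 1 then (1 + t * l j * (1 + k_tilde i k j)) * x c else 0)
      + (if c = j then - t * l j * q_up i b j * x c else 0)
      + (if c = j - 2 then - t * l j * q_down i b j * x c else 0)
      + (if c = M then - t * l j * k_tilde i k j * x c else 0)"
      by cases (use m c in \<open>auto simp: N_tilde_def N_tilde_entry_def\<close>)
  qed simp
  also have "\<dots> = (1 + t * l j * (1 + k_tilde i k j)) * x (j - 1) - t * l j * q_up i b j * x j
      - t * l j * q_down i b j * x (j - 2) - t * l j * k_tilde i k j * x M"
    using m by (simp add: sum.distrib)
  finally show ?thesis
    by (simp add: algebra_simps)
qed

lemma monotone_mat_N_tilde:
  assumes t: "0 < t" and mono: "strict_mono_on {1..M} i"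
    and b: "\<forall>j\<in>{2..M - 1}. - (1 / (i (j + 1) - i j)) < b j \<and> b j < 1 / (i j - i (j - 1))"
    and k: "\<forall>j\<in>{2..M - 1}. k j \<ge> 0" and l: "\<forall>j\<in>{2..M - 1}. l j \<ge> 0"
  shows "monotone_mat (M + 1) (N_tilde M i b t k l)"
proof -
  note i = strict_mono_on_neighbours[OF mono]
  have signs: "0 < q_up i b j" "0 < q_down i b j" "0 \<le> k_tilde i k j" "0 \<le> t * l j"
    if "j \<in> {2..M - 1}" for j
    using q_up_pos[OF i[OF that], of b] q_down_pos[OF i[OF that], of b]
      k_tilde_nonneg[OF i[OF that], of k] b k l t that by auto
  have off: "N_tilde M i b t k l $$ (r, c) \<le> 0" if "r < M + 1" "c < M + 1" "c \<noteq> r" for r c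
  proof (cases "r + 1 \<in> {2..M - 1}")
    case True
    then show ?thesis
      using signs[OF True] that by (auto simp: N_tilde_def N_tilde_entry_def)
  qed (use that in \<open>auto simp: N_tilde_def N_tilde_entry_def\<close>)
  have row: "(\<Sum>c<M + 1. N_tilde M i b t k l $$ (r, c)) = 1" if r: "r < M + 1" for r
  proof (cases "r + 1 \<in> {2..M - 1}")
    case True
    then have "(1 + k_tilde i k (r + 1)) - q_up i b (r + 1) - q_down i b (r + 1)
        - k_tilde i k (r + 1) = 0"
      using q_up_plus_q_down[OF i[OF True], of b] by simp
    then show ?thesis
      using N_tilde_row_sum_interior[OF True, of i b t k l "\<lambda>_. 1"] by simp
  qed (use N_tilde_row_sum_boundary[OF r, of i b t k l "\<lambda>_. 1"] in simp)
  show ?thesis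
    unfolding monotone_mat_def
    using N_tilde_carrier Z_mat_nonneg_solution[OF N_tilde_carrier off] row by auto
qed

definition barrier :: "nat \<Rightarrow> real \<Rightarrow> real vec" where
  "barrier M K = vec (M + 1) (\<lambda>j. if j = M then 1 else 1 - K ^ j / K ^ M)"

lemma barrier_le_N_tilde_mult:
  assumes t: "0 < t" and mono: "strict_mono_on {1..M} i"
    and b: "\<forall>j\<in>{2..M - 1}. b j < 1 / (i j - i (j - 1))"
    and l: "\<forall>j\<in>{2..M - 1}. l j \<ge> 0"
    and K: "1 \<le> K" "\<forall>j\<in>{2..M - 1}. 1 + k_tilde i k j \<le> K * q_up i b j"
  shows "barrier M K \<le> N_tilde M i b t k l *\<^sub>v barrier M K"
proof -
  let ?N = "N_tilde M i b t k l" and ?h = "barrier M K"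
  note i = strict_mono_on_neighbours[OF mono]
  have dim: "dim_row ?N = M + 1" "dim_col ?N = M + 1" "dim_vec ?h = M + 1"
    by (simp_all add: N_tilde_def barrier_def)
  have "?h $ r \<le> (?N *\<^sub>v ?h) $ r" if r: "r < M + 1" for r
  proof -
    have mult: "(?N *\<^sub>v ?h) $ r = (\<Sum>c<M + 1. ?N $$ (r, c) * ?h $ c)"
      using r dim by (simp add: scalar_prod_def atLeast0LessThan)
    show ?thesis
    proof (cases "r + 1 \<in> {2..M - 1}")
      case False
      with mult N_tilde_row_sum_boundary[OF r] show ?thesis by simp
    next
      case True
      define j where "j = r + 1"
      define g where "g c = K ^ c / K ^ M" for c
      have j: "j \<in> {2..M - 1}" "r = j - 1"
        using True by (auto simp: j_def)
      have g0: "0 \<le> g c" for c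
        using K(1) by (simp add: g_def)
      have gj: "g j = K * g (j - 1)"
        by (cases j) (use j in \<open>auto simp: g_def\<close>)
      have q: "q_up i b j + q_down i b j = 1" "0 < q_down i b j"
        using q_up_plus_q_down[OF i[OF j(1)], of b] q_down_pos[OF i[OF j(1)], of b] b j(1) by auto
      have "(1 + k_tilde i k j) * g (j - 1) \<le> K * q_up i b j * g (j - 1)"
        using K(2) j g0 by (intro mult_right_mono) auto
      also have "\<dots> \<le> q_up i b j * g j + q_down i b j * g (j - 2)"
        using gj q(2) g0[of "j - 2"] by simp
      finally have "0 \<le> q_up i b j * g j + q_down i b j * g (j - 2) - (1 + k_tilde i k j) * g (j - 1)"
        by simp
      also have "\<dots> = (1 + k_tilde i k j) * (1 - g (j - 1)) - q_up i b j * (1 - g j)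
          - q_down i b j * (1 - g (j - 2)) - k_tilde i k j"
        using q(1) by (simp add: algebra_simps)
      also have "\<dots> = (1 + k_tilde i k j) * ?h $ (j - 1) - q_up i b j * ?h $ j
          - q_down i b j * ?h $ (j - 2) - k_tilde i k j * ?h $ M"
        using j by (auto simp: barrier_def g_def)
      finally have "0 \<le> t * l j * \<dots>"
        using t l j by simp
      then show ?thesis
        unfolding mult unfolding j(2) N_tilde_row_sum_interior[OF j(1)] by simp
    qed
  qed
  then show ?thesis
    using dim by (simp add: less_eq_vec_def)
qed

theorem lemma7p2:
  fixes M p :: nat and t :: real and i b k :: "nat \<Rightarrow> real"
  assumes "M \<ge> 3"
    and "t > 0"
    and "strict_mono_on {1..M} i"
    and "\<forall>j\<in>{2..M - 1}. - (1 / (i (j + 1) - i j)) < b j \<and> b j < 1 / (i j - i (j - 1))"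
    and "\<forall>j\<in>{2..M - 1}. k j \<ge> 0"
    and "p \<ge> 1"
  shows "\<exists>c>0. \<forall>l :: nat \<Rightarrow> real. (\<forall>j\<in>{2..M - 1}. l j \<ge> 0) \<longrightarrow>
           invertible_mat (N_tilde M i b t k l) \<and>
           (\<forall>j\<in>{1..M}. mat_neg_pow (N_tilde M i b t k l) p $$ (j - 1, M) < 1 - c)"
proof -
  define K where "K = Max (insert 1 ((\<lambda>j. (1 + k_tilde i k j) / q_up i b j) ` {2..M - 1}))"
  have K1: "1 \<le> K"
    unfolding K_def by (intro Max_ge) auto
  have K2: "1 + k_tilde i k j \<le> K * q_up i b j" if j: "j \<in> {2..M - 1}" for j
  proof -
    have "(1 + k_tilde i k j) / q_up i b j \<le> K"
      unfolding K_def using j by (intro Max_ge) auto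
    moreover have "0 < q_up i b j"
      using j assms(4) strict_mono_on_neighbours[OF assms(3) j] by (intro q_up_pos) auto
    ultimately show ?thesis
      by (simp add: divide_le_eq)
  qed
  define c where "c = 1 / K ^ M / 2"
  have c: "0 < c"
    using K1 by (simp add: c_def)
  have "invertible_mat (N_tilde M i b t k l) \<and>
      (\<forall>j\<in>{1..M}. mat_neg_pow (N_tilde M i b t k l) p $$ (j - 1, M) < 1 - c)"
    if l: "\<forall>j\<in>{2..M - 1}. l j \<ge> 0" for l
  proof (intro conjI ballI)
    let ?N = "N_tilde M i b t k l"
    have N: "monotone_mat (M + 1) ?N"
      using monotone_mat_N_tilde assms l by blast
    then show "invertible_mat ?N"
      by (rule invertible_monotone_mat)
    fix j assume j: "j \<in> {1..M}"
    then have jM: "j - 1 < M + 1"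
      by (cases j) auto
    obtain B where "mat_inverse ?N = Some B" "B \<in> carrier_mat (M + 1) (M + 1)"
      using monotone_mat_inverse[OF N] .
    then have pow: "mat_neg_pow ?N p \<in> carrier_mat (M + 1) (M + 1)"
      by (simp add: mat_neg_pow_def)
    have "unit_vec (M + 1) M \<le> barrier M K"
      using K1 by (auto simp: less_eq_vec_def barrier_def unit_vec_def intro!: power_increasing)
    then have le: "mat_neg_pow ?N p *\<^sub>v unit_vec (M + 1) M \<le> barrier M K"
      using barrier_le_N_tilde_mult assms l K1 K2
      by (intro mat_neg_pow_mult_vec_le[OF N]) (auto simp: barrier_def)
    have "mat_neg_pow ?N p $$ (j - 1, M) = (mat_neg_pow ?N p *\<^sub>v unit_vec (M + 1) M) $ (j - 1)"
      using pow jM by simp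
    also have "\<dots> \<le> barrier M K $ (j - 1)"
      using le jM unfolding less_eq_vec_def barrier_def dim_vec by blast
    also have "\<dots> = 1 - K ^ (j - 1) / K ^ M"
      using j by (auto simp: barrier_def)
    also have "\<dots> \<le> 1 - 2 * c"
      using K1 by (simp add: c_def divide_right_mono)
    also have "\<dots> < 1 - c"
      using c by simp
    finally show "mat_neg_pow ?N p $$ (j - 1, M) < 1 - c" .
  qed
  with c show ?thesis by blast
qed

end
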